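(* Deterministic policies are not sufficient to stabilize an MDP-JLS: there exists an MDP-JLS for which no deterministic policy induces a mean-square stable MJLS, but for which some randomized policy induces a mean-square stable MJLS.
   Context: An MDP is a tuple $\mathcal{M}=(S,\hat{s},\Sigma,T)$ with finite state set $S=\{s_1,\dots,s_N\}$, initial state $\hat s\in S$, finite action set $\Sigma$, and transition function $T(s,\sigma,s')=p(s'|s,\sigma)$. If $\sigma$ is available at $s$ then $T(s,\sigma,\cdot)$ is a probability distribution; otherwise $T(s,\sigma,\cdot)=0$ and policies do not select $\sigma$ at $s$. A (randomized) policy $\pi:S\times\Sigma\to[0,1]$ gives the probability $\pi(s,\sigma)$ of taking action $\sigma$ at $s$; a deterministic policy selects a single action with probability one in each state. Under $\pi$ the MDP reduces to a discrete-time Markov chain (DTMC) $(S,\hat s,P)$ with $P_{ij}=\sum_{\sigma}T(s_i,\sigma,s_j)\pi(s_i,\sigma)$. An MDP-JLS is the switched system $x(k+1)=A_{s_k}x(k)$, $x(k)\in\mathbb{R}^n$, with matrix $A_i\in\mathbb{R}^{n\times n}$ used when the mode at time $k$ is $s_i$, and with the mode process governed by $\mathcal{M}$. Given a policy it becomes a Markov jump linear system (MJLS): the modes follow the induced DTMC. An MJLS is mean-square stable if $\lim_{k\to\infty}\|E[x(k)x'(k)]\|_\infty=0$ for any initial condition $x_0$, where $'$ denotes transpose. *)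

theory Defs
  imports "HOL-Probability.Probability_Measure" "Jordan_Normal_Form.Matrix"
begin

unbundle no vec_syntax

section \<open>Markov decision processes and policies\<close>

record ('s, 'a) mdp =
  states :: "'s set"
  init :: "'s"
  actions :: "'a set"
  transition :: "'s \<Rightarrow> 'a \<Rightarrow> 's \<Rightarrow> real"

text \<open>Availability is not separate data: an action is unavailable exactly when its transition
  function vanishes identically.\<close>

definition available :: "('s, 'a, 'z) mdp_scheme \<Rightarrow> 's \<Rightarrow> 'a \<Rightarrow> bool" where
  "available M s \<sigma> \<longleftrightarrow> (\<exists>s'\<in>states M. transition M s \<sigma> s' \<noteq> 0)"

definition is_distribution_on :: "'b set \<Rightarrow> ('b \<Rightarrow> real) \<Rightarrow> bool" where
  "is_distribution_on B p \<longleftrightarrow> (\<forall>b\<in>B. 0 \<le> p b) \<and> (\<Sum>b\<in>B. p b) = 1"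

definition is_mdp :: "('s, 'a, 'z) mdp_scheme \<Rightarrow> bool" where
  "is_mdp M \<longleftrightarrow>
     finite (states M) \<and> init M \<in> states M \<and> finite (actions M) \<and>
     (\<forall>s\<in>states M. \<forall>\<sigma>\<in>actions M.
        available M s \<sigma> \<longrightarrow> is_distribution_on (states M) (transition M s \<sigma>))"

definition is_policy :: "('s, 'a, 'z) mdp_scheme \<Rightarrow> ('s \<Rightarrow> 'a \<Rightarrow> real) \<Rightarrow> bool" where
  "is_policy M \<pi> \<longleftrightarrow>
     (\<forall>s\<in>states M. is_distribution_on (actions M) (\<pi> s) \<and>
        (\<forall>\<sigma>\<in>actions M. \<not> available M s \<sigma> \<longrightarrow> \<pi> s \<sigma> = 0))"

definition is_deterministic_policy :: "('s, 'a, 'z) mdp_scheme \<Rightarrow> ('s \<Rightarrow> 'a \<Rightarrow> real) \<Rightarrow> bool" where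
  "is_deterministic_policy M \<pi> \<longleftrightarrow>
     is_policy M \<pi> \<and> (\<forall>s\<in>states M. \<exists>\<sigma>\<in>actions M. \<pi> s \<sigma> = 1)"

definition induced_prob :: "('s, 'a, 'z) mdp_scheme \<Rightarrow> ('s \<Rightarrow> 'a \<Rightarrow> real) \<Rightarrow> 's \<Rightarrow> 's \<Rightarrow> real" where
  "induced_prob M \<pi> i j = (\<Sum>\<sigma>\<in>actions M. transition M i \<sigma> j * \<pi> i \<sigma>)"

section \<open>Markov jump linear systems\<close>

record 's mjls =
  modes :: "'s set"
  init_mode :: "'s"
  mode_prob :: "'s \<Rightarrow> 's \<Rightarrow> real"
  sys_dim :: nat
  sys_mat :: "'s \<Rightarrow> real mat"

text \<open>The law of the first \<open>k + 1\<close> modes \<open>(s\<^sub>0, \<dots>, s\<^sub>k)\<close> of the Markov chain: a path has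
  probability \<open>P(s\<^sub>0, s\<^sub>1) \<cdots> P(s\<^sub>k\<^sub>-\<^sub>1, s\<^sub>k)\<close> if it starts in the initial mode, and \<open>0\<close> otherwise.
  Since \<open>x(k)\<close> depends only on \<open>s\<^sub>0, \<dots>, s\<^sub>k\<^sub>-\<^sub>1\<close>, this suffices to define its moments.\<close>

definition path_prob :: "('s, 'z) mjls_scheme \<Rightarrow> nat \<Rightarrow> (nat \<Rightarrow> 's) \<Rightarrow> real" where
  "path_prob J k \<omega> =
     (if \<omega> 0 = init_mode J then \<Prod>t<k. mode_prob J (\<omega> t) (\<omega> (Suc t)) else 0)"

definition path_law :: "('s, 'z) mjls_scheme \<Rightarrow> nat \<Rightarrow> (nat \<Rightarrow> 's) measure" where
  "path_law J k = point_measure ({..k} \<rightarrow>\<^sub>E modes J) (\<lambda>\<omega>. ennreal (path_prob J k \<omega>))"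

primrec trajectory :: "('s, 'z) mjls_scheme \<Rightarrow> real vec \<Rightarrow> (nat \<Rightarrow> 's) \<Rightarrow> nat \<Rightarrow> real vec" where
  "trajectory J x0 \<omega> 0 = x0"
| "trajectory J x0 \<omega> (Suc k) = sys_mat J (\<omega> k) *\<^sub>v trajectory J x0 \<omega> k"

definition second_moment :: "('s, 'z) mjls_scheme \<Rightarrow> real vec \<Rightarrow> nat \<Rightarrow> real mat" where
  "second_moment J x0 k =
     mat (sys_dim J) (sys_dim J)
       (\<lambda>(i, j). \<integral>\<omega>. trajectory J x0 \<omega> k $ i * trajectory J x0 \<omega> k $ j \<partial>path_law J k)"

text \<open>The norm induced by the maximum norm on vectors (the maximal absolute row sum), for
  matrices with at least one row.\<close>

definition mat_inf_norm :: "real mat \<Rightarrow> real" where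
  "mat_inf_norm B = Max ((\<lambda>i. \<Sum>j<dim_col B. \<bar>B $$ (i, j)\<bar>) ` {..<dim_row B})"

definition mean_square_stable :: "('s, 'z) mjls_scheme \<Rightarrow> bool" where
  "mean_square_stable J \<longleftrightarrow>
     (\<forall>x0\<in>carrier_vec (sys_dim J). (\<lambda>k. mat_inf_norm (second_moment J x0 k)) \<longlonglongrightarrow> 0)"

section \<open>MDP jump linear systems\<close>

record ('s, 'a) mdp_jls = "('s, 'a) mdp" +
  jls_dim :: nat
  jls_mat :: "'s \<Rightarrow> real mat"

definition is_mdp_jls :: "('s, 'a, 'z) mdp_jls_scheme \<Rightarrow> bool" where
  "is_mdp_jls M \<longleftrightarrow>
     is_mdp M \<and> 0 < jls_dim M \<and>
     (\<forall>s\<in>states M. jls_mat M s \<in> carrier_mat (jls_dim M) (jls_dim M))"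

definition induced_mjls :: "('s, 'a, 'z) mdp_jls_scheme \<Rightarrow> ('s \<Rightarrow> 'a \<Rightarrow> real) \<Rightarrow> 's mjls" where
  "induced_mjls M \<pi> =
     \<lparr>modes = states M, init_mode = init M, mode_prob = induced_prob M \<pi>,
      sys_dim = jls_dim M, sys_mat = jls_mat M\<rparr>"

section \<open>Policies induce Markov chains\<close>

lemma induced_prob_distribution:
  assumes "is_mdp M" "is_policy M \<pi>" "s \<in> states M"
  shows "is_distribution_on (states M) (induced_prob M \<pi> s)"
proof -
  let ?T = "transition M s"
  have pol: "is_distribution_on (actions M) (\<pi> s)"
    and unav: "\<And>\<sigma>. \<sigma> \<in> actions M \<Longrightarrow> \<not> available M s \<sigma> \<Longrightarrow> \<pi> s \<sigma> = 0"
    using assms by (auto simp: is_policy_def)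
  have av: "\<And>\<sigma>. \<sigma> \<in> actions M \<Longrightarrow> available M s \<sigma> \<Longrightarrow> is_distribution_on (states M) (?T \<sigma>)"
    using assms by (auto simp: is_mdp_def)
  have nn: "0 \<le> ?T \<sigma> s' * \<pi> s \<sigma>" if "\<sigma> \<in> actions M" "s' \<in> states M" for \<sigma> s'
  proof (cases "available M s \<sigma>")
    case True
    then show ?thesis using av[of \<sigma>] pol that by (auto simp: is_distribution_on_def)
  next
    case False
    then show ?thesis using unav that by auto
  qed
  have one: "(\<Sum>s'\<in>states M. ?T \<sigma> s' * \<pi> s \<sigma>) = \<pi> s \<sigma>" if "\<sigma> \<in> actions M" for \<sigma>
  proof (cases "available M s \<sigma>")
    case True
    then show ?thesis using av[of \<sigma>] that
      by (simp add: is_distribution_on_def flip: sum_distrib_right)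
  next
    case False
    then show ?thesis using unav that by auto
  qed
  have "(\<Sum>s'\<in>states M. induced_prob M \<pi> s s')
      = (\<Sum>\<sigma>\<in>actions M. \<Sum>s'\<in>states M. ?T \<sigma> s' * \<pi> s \<sigma>)"
    unfolding induced_prob_def by (rule sum.swap)
  also have "\<dots> = (\<Sum>\<sigma>\<in>actions M. \<pi> s \<sigma>)" using one by simp
  also have "\<dots> = 1" using pol by (simp add: is_distribution_on_def)
  finally show ?thesis
    using nn by (auto simp: is_distribution_on_def induced_prob_def intro!: sum_nonneg)
qed

lemma path_prob_nonneg:
  assumes "\<And>s. s \<in> modes J \<Longrightarrow> is_distribution_on (modes J) (mode_prob J s)"
    and "\<omega> \<in> {..k} \<rightarrow>\<^sub>E modes J"
  shows "0 \<le> path_prob J k \<omega>"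
proof -
  have "0 \<le> mode_prob J (\<omega> t) (\<omega> (Suc t))" if "t < k" for t
  proof -
    have "\<omega> t \<in> modes J" "\<omega> (Suc t) \<in> modes J" using assms(2) that by (auto simp: PiE_iff)
    then show ?thesis using assms(1) by (auto simp: is_distribution_on_def)
  qed
  then show ?thesis by (auto simp: path_prob_def intro!: prod_nonneg)
qed

lemma sum_path_prob:
  assumes fin: "finite (modes J)" and init: "init_mode J \<in> modes J"
    and distr: "\<And>s. s \<in> modes J \<Longrightarrow> is_distribution_on (modes J) (mode_prob J s)"
  shows "(\<Sum>\<omega>\<in>{..k} \<rightarrow>\<^sub>E modes J. path_prob J k \<omega>) = 1"
proof (induction k)
  let ?S = "modes J"
  have step: "(\<Sum>\<omega>\<in>insert i I \<rightarrow>\<^sub>E ?S. f \<omega>) = (\<Sum>\<omega>\<in>I \<rightarrow>\<^sub>E ?S. \<Sum>s\<in>?S. f (fun_upd \<omega> i s))"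
    if "i \<notin> I" for i :: nat and I and f :: "(nat \<Rightarrow> 'a) \<Rightarrow> real"
  proof -
    have "(\<Sum>\<omega>\<in>insert i I \<rightarrow>\<^sub>E ?S. f \<omega>) = (\<Sum>(s, \<omega>)\<in>?S \<times> (I \<rightarrow>\<^sub>E ?S). f (fun_upd \<omega> i s))"
      unfolding PiE_insert_eq
      by (subst sum.reindex) (use inj_combinator[OF that] in \<open>auto simp: case_prod_beta\<close>)
    also have "\<dots> = (\<Sum>s\<in>?S. \<Sum>\<omega>\<in>I \<rightarrow>\<^sub>E ?S. f (fun_upd \<omega> i s))"
      by (simp add: sum.cartesian_product)
    also have "\<dots> = (\<Sum>\<omega>\<in>I \<rightarrow>\<^sub>E ?S. \<Sum>s\<in>?S. f (fun_upd \<omega> i s))" by (rule sum.swap)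
    finally show ?thesis .
  qed
  {
    case 0
    have "{..0::nat} = insert 0 {}" by auto
    then show ?case using fin init by (simp add: step path_prob_def)
  next
    case (Suc k)
    have upd: "path_prob J (Suc k) (fun_upd \<omega> (Suc k) s) = path_prob J k \<omega> * mode_prob J (\<omega> k) s"
      for \<omega> s by (simp add: path_prob_def)
    have last: "(\<Sum>s\<in>?S. mode_prob J (\<omega> k) s) = 1" if "\<omega> \<in> {..k} \<rightarrow>\<^sub>E ?S" for \<omega>
    proof -
      have "\<omega> k \<in> ?S" using that by (auto simp: PiE_iff)
      then show ?thesis using distr by (auto simp: is_distribution_on_def)
    qed
    have "(\<Sum>\<omega>\<in>{..Suc k} \<rightarrow>\<^sub>E ?S. path_prob J (Suc k) \<omega>)
        = (\<Sum>\<omega>\<in>{..k} \<rightarrow>\<^sub>E ?S. path_prob J k \<omega> * (\<Sum>s\<in>?S. mode_prob J (\<omega> k) s))"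
      by (simp only: atMost_Suc) (simp add: step upd sum_distrib_left del: fun_upd_apply)
    also have "\<dots> = (\<Sum>\<omega>\<in>{..k} \<rightarrow>\<^sub>E ?S. path_prob J k \<omega>)" using last by simp
    finally show ?case using Suc.IH by simp
  }
qed

lemma prob_space_path_law:
  assumes "is_mdp_jls M" "is_policy M \<pi>"
  shows "prob_space (path_law (induced_mjls M \<pi>) k)"
proof (rule prob_spaceI)
  let ?J = "induced_mjls M \<pi>"
  let ?\<Omega> = "{..k} \<rightarrow>\<^sub>E modes ?J"
  have mdp: "is_mdp M" using assms(1) by (simp add: is_mdp_jls_def)
  have fin: "finite (modes ?J)" and init: "init_mode ?J \<in> modes ?J"
    using mdp by (simp_all add: is_mdp_def induced_mjls_def)
  have distr: "is_distribution_on (modes ?J) (mode_prob ?J s)" if "s \<in> modes ?J" for s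
    using induced_prob_distribution[OF mdp assms(2)] that by (simp add: induced_mjls_def)
  have "finite ?\<Omega>" using fin by (intro finite_PiE) auto
  then have "emeasure (path_law ?J k) (space (path_law ?J k))
      = (\<Sum>\<omega>\<in>?\<Omega>. ennreal (path_prob ?J k \<omega>))"
    by (simp add: path_law_def space_point_measure emeasure_point_measure_finite)
  also have "\<dots> = ennreal (\<Sum>\<omega>\<in>?\<Omega>. path_prob ?J k \<omega>)"
    by (rule sum_ennreal) (rule path_prob_nonneg[OF distr])
  also have "\<dots> = 1" using sum_path_prob[OF fin init distr] by simp
  finally show "emeasure (path_law ?J k) (space (path_law ?J k)) = 1" .
qed

end

theory Submission
  imports Defs "HOL-Probability.Characteristic_Functions"
begin

unbundle no vec_syntax

text \<open>A hub mode with the identity matrix leads, by the choice of an action, to one of two spoke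
  modes, whose matrices are the projections onto the two coordinate axes; both spokes lead back
  to the hub. A deterministic policy visits only one spoke and leaves the coordinate kept by it
  constant. A policy that takes both actions with probability \<open>1/2\<close> halves the mean of the square
  of each coordinate every two steps.\<close>

section \<open>Expectations over paths of a finite chain\<close>

lemma sum_PiE_insert:
  fixes f :: "('i \<Rightarrow> 'b) \<Rightarrow> 'c :: comm_monoid_add"
  assumes "i \<notin> I"
  shows "(\<Sum>\<omega>\<in>insert i I \<rightarrow>\<^sub>E S. f \<omega>) = (\<Sum>\<omega>\<in>I \<rightarrow>\<^sub>E S. \<Sum>s\<in>S. f (fun_upd \<omega> i s))"
proof -
  have "(\<Sum>\<omega>\<in>insert i I \<rightarrow>\<^sub>E S. f \<omega>) = (\<Sum>(s, \<omega>)\<in>S \<times> (I \<rightarrow>\<^sub>E S). f (fun_upd \<omega> i s))"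
    unfolding PiE_insert_eq
    by (subst sum.reindex) (use inj_combinator[OF assms] in \<open>auto simp: case_prod_beta\<close>)
  also have "\<dots> = (\<Sum>s\<in>S. \<Sum>\<omega>\<in>I \<rightarrow>\<^sub>E S. f (fun_upd \<omega> i s))"
    by (simp add: sum.cartesian_product)
  finally show ?thesis
    by (simp only: sum.swap[of _ S])
qed

text \<open>The density passes through \<open>ennreal\<close>, which cuts negative values to 0; the
  distribution hypothesis makes path weights nonnegative, so none is lost.\<close>

lemma integral_path_law:
  assumes "finite (modes J)"
    and "\<And>s. s \<in> modes J \<Longrightarrow> is_distribution_on (modes J) (mode_prob J s)"
  shows "(\<integral>\<omega>. f \<omega> \<partial>path_law J k) = (\<Sum>\<omega>\<in>{..k} \<rightarrow>\<^sub>E modes J. path_prob J k \<omega> * f \<omega>)"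
  unfolding path_law_def
  using assms
  by (subst lebesgue_integral_point_measure_finite) (auto intro: finite_PiE path_prob_nonneg)

text \<open>The backward operator of the chain, weighted by \<open>w\<close>: one step of a discrete
  Feynman-Kac recursion. The weight belongs to the mode that is left, just as x(k) involves the
  modes before time k only.\<close>

definition transfer ::
    "('s, 'z) mjls_scheme \<Rightarrow> ('s \<Rightarrow> real) \<Rightarrow> ('s \<Rightarrow> real) \<Rightarrow> 's \<Rightarrow> real" where
  "transfer J w g s = w s * (\<Sum>s'\<in>modes J. mode_prob J s s' * g s')"

text \<open>Feynman-Kac formula: summing out the last mode turns the terminal function
  \<open>g\<close> into \<open>transfer J w g\<close> on paths one step shorter. Hence the induction
  keeps \<open>g\<close> arbitrary.\<close>

lemma sum_path_prob_weighted:
  assumes fin: "finite (modes J)" and init: "init_mode J \<in> modes J"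
  shows "(\<Sum>\<omega>\<in>{..k} \<rightarrow>\<^sub>E modes J. path_prob J k \<omega> * ((\<Prod>t<k. w (\<omega> t)) * g (\<omega> k)))
    = (transfer J w ^^ k) g (init_mode J)"
proof (induction k arbitrary: g)
  case 0
  have "{..0::nat} = insert 0 {}" by auto
  then show ?case
    using fin init by (simp add: sum_PiE_insert path_prob_def mult_delta_left cong: if_cong)
next
  case (Suc k)
  have upd: "path_prob J (Suc k) (fun_upd \<omega> (Suc k) s) = path_prob J k \<omega> * mode_prob J (\<omega> k) s"
    for \<omega> s by (simp add: path_prob_def)
  have "(\<Sum>\<omega>\<in>{..Suc k} \<rightarrow>\<^sub>E modes J.
        path_prob J (Suc k) \<omega> * ((\<Prod>t<Suc k. w (\<omega> t)) * g (\<omega> (Suc k))))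
      = (\<Sum>\<omega>\<in>{..k} \<rightarrow>\<^sub>E modes J. \<Sum>s\<in>modes J.
        path_prob J k \<omega> * mode_prob J (\<omega> k) s * ((\<Prod>t<k. w (\<omega> t)) * w (\<omega> k) * g s))"
    by (simp only: atMost_Suc) (simp add: sum_PiE_insert upd del: fun_upd_apply, simp)
  also have "\<dots> = (\<Sum>\<omega>\<in>{..k} \<rightarrow>\<^sub>E modes J.
        path_prob J k \<omega> * ((\<Prod>t<k. w (\<omega> t)) * transfer J w g (\<omega> k)))"
    by (simp add: transfer_def sum_distrib_left mult_ac)
  \<comment> \<open>The induction hypothesis is taken at \<open>transfer J w g\<close>, which puts
    the new factor innermost; \<open>funpow_swap1\<close> moves it outside.\<close>
  also have "\<dots> = (transfer J w ^^ Suc k) g (init_mode J)"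
    by (simp add: Suc.IH funpow_swap1)
  finally show ?case .
qed

section \<open>Second moments of diagonal systems\<close>

lemma trajectory_carrier:
  assumes "x0 \<in> carrier_vec n" "\<And>s. sys_mat J s \<in> carrier_mat n n"
  shows "trajectory J x0 \<omega> k \<in> carrier_vec n"
  using assms by (induction k) (auto intro: mult_mat_vec_carrier)

lemma mat_diag_mult_vec:
  assumes "v \<in> carrier_vec n" "i < n"
  shows "(mat_diag n d *\<^sub>v v) $ i = d i * v $ i"
proof -
  have "(mat_diag n d *\<^sub>v v) $ i = (\<Sum>j\<in>{0..<n}. (if i = j then d j else 0) * v $ j)"
    using assms by (simp add: mat_diag_def scalar_prod_def)
  also have "\<dots> = (\<Sum>j\<in>{0..<n}. if i = j then d j * v $ j else 0)"
    by (rule sum.cong) auto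
  finally show ?thesis using assms by simp
qed

lemma trajectory_diag:
  assumes "\<And>s. sys_mat J s = mat_diag n (d s)" "x0 \<in> carrier_vec n" "i < n"
  shows "trajectory J x0 \<omega> k $ i = (\<Prod>t<k. d (\<omega> t) i) * x0 $ i"
proof (induction k)
  case (Suc k)
  have "trajectory J x0 \<omega> k \<in> carrier_vec n"
    using assms by (intro trajectory_carrier) auto
  then show ?case
    using assms Suc by (simp add: mat_diag_mult_vec)
qed simp

text \<open>Coordinates evolve separately, so the product of two of them is a product of weights
  along the path, and the weighted path sum with terminal function 1 gives its mean.\<close>

lemma second_moment_diag:
  assumes fin: "finite (modes J)" and init: "init_mode J \<in> modes J"
    and distr: "\<And>s. s \<in> modes J \<Longrightarrow> is_distribution_on (modes J) (mode_prob J s)"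
    and diag: "\<And>s. sys_mat J s = mat_diag (sys_dim J) (d s)"
    and x0: "x0 \<in> carrier_vec (sys_dim J)" and ij: "i < sys_dim J" "j < sys_dim J"
  shows "second_moment J x0 k $$ (i, j)
    = (transfer J (\<lambda>s. d s i * d s j) ^^ k) (\<lambda>_. 1) (init_mode J) * (x0 $ i * x0 $ j)"
proof -
  let ?w = "\<lambda>s. d s i * d s j"
  have "second_moment J x0 k $$ (i, j)
      = (\<Sum>\<omega>\<in>{..k} \<rightarrow>\<^sub>E modes J.
          path_prob J k \<omega> * ((\<Prod>t<k. ?w (\<omega> t)) * 1) * (x0 $ i * x0 $ j))"
    using ij by (simp add: second_moment_def integral_path_law[OF fin distr]
        trajectory_diag[OF diag x0] prod.distrib mult_ac)
  also have "\<dots> = (\<Sum>\<omega>\<in>{..k} \<rightarrow>\<^sub>E modes J.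
          path_prob J k \<omega> * ((\<Prod>t<k. ?w (\<omega> t)) * 1)) * (x0 $ i * x0 $ j)"
    by (rule sum_distrib_right[symmetric])
  also have "\<dots> = (transfer J ?w ^^ k) (\<lambda>_. 1) (init_mode J) * (x0 $ i * x0 $ j)"
    by (subst sum_path_prob_weighted[OF fin init, of k ?w "\<lambda>_. 1"]) (rule refl)
  finally show ?thesis .
qed

section \<open>Convergence in norm and entrywise convergence\<close>

lemma mat_inf_norm_ge_entry:
  assumes "i < dim_row B" "j < dim_col B"
  shows "\<bar>B $$ (i, j)\<bar> \<le> mat_inf_norm B"
proof -
  have "\<bar>B $$ (i, j)\<bar> \<le> (\<Sum>j<dim_col B. \<bar>B $$ (i, j)\<bar>)"
    using assms by (intro member_le_sum) auto
  also have "\<dots> \<le> mat_inf_norm B"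
    unfolding mat_inf_norm_def using assms by (intro Max_ge) auto
  finally show ?thesis .
qed

lemma mat_inf_norm_le_sum:
  assumes "0 < dim_row B"
  shows "mat_inf_norm B \<le> (\<Sum>i<dim_row B. \<Sum>j<dim_col B. \<bar>B $$ (i, j)\<bar>)"
  unfolding mat_inf_norm_def
  using assms by (subst Max_le_iff)
    (auto intro!: member_le_sum[where f = "\<lambda>i. \<Sum>j<dim_col B. \<bar>B $$ (i, j)\<bar>"] sum_nonneg)

text \<open>The norm lies between the absolute value of any single entry and the sum of all of
  them.\<close>

lemma mat_inf_norm_tendsto_0_iff:
  assumes B: "\<And>k. B k \<in> carrier_mat m n" and pos: "0 < m" "0 < n"
  shows "(\<lambda>k. mat_inf_norm (B k)) \<longlonglongrightarrow> 0 \<longleftrightarrow> (\<forall>i<m. \<forall>j<n. (\<lambda>k. B k $$ (i, j)) \<longlonglongrightarrow> 0)"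
proof (intro iffI allI impI)
  fix i j assume "(\<lambda>k. mat_inf_norm (B k)) \<longlonglongrightarrow> 0" "i < m" "j < n"
  then show "(\<lambda>k. B k $$ (i, j)) \<longlonglongrightarrow> 0"
    using B by (elim Lim_null_comparison[rotated])
      (intro always_eventually allI, simp add: mat_inf_norm_ge_entry carrier_matD[OF B])
next
  assume lim: "\<forall>i<m. \<forall>j<n. (\<lambda>k. B k $$ (i, j)) \<longlonglongrightarrow> 0"
  have sum0: "(\<lambda>k. \<Sum>i<m. \<Sum>j<n. \<bar>B k $$ (i, j)\<bar>) \<longlonglongrightarrow> 0"
    using lim by (intro tendsto_null_sum tendsto_rabs_zero) auto
  have nonneg: "0 \<le> mat_inf_norm (B k)" for k
    using mat_inf_norm_ge_entry[of 0 "B k" 0] pos by (simp add: carrier_matD[OF B])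
  show "(\<lambda>k. mat_inf_norm (B k)) \<longlonglongrightarrow> 0"
  proof (rule Lim_null_comparison[OF always_eventually sum0], rule allI)
    fix k
    show "norm (mat_inf_norm (B k)) \<le> (\<Sum>i<m. \<Sum>j<n. \<bar>B k $$ (i, j)\<bar>)"
      using mat_inf_norm_le_sum[of "B k"] nonneg[of k] pos by (simp add: carrier_matD[OF B])
  qed
qed

section \<open>The hub system\<close>

text \<open>Indices are aligned: action \<open>i\<close> at the hub 0 leads to spoke
  \<open>Suc i\<close>, which keeps coordinate \<open>i\<close>. Both actions are available in every
  mode, and the matrices are diagonal at every natural number, as \<open>second_moment_diag\<close>
  demands.\<close>

definition hub_jls :: "(nat, nat) mdp_jls" where
  "hub_jls = \<lparr>states = {0, 1, 2}, init = 0, actions = {0, 1},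
     transition = (\<lambda>s \<sigma> s'. of_bool (s' = (if s = 0 then Suc \<sigma> else 0))),
     jls_dim = 2, jls_mat = (\<lambda>s. mat_diag 2 (\<lambda>i. of_bool (s = 0 \<or> s = Suc i)))\<rparr>"

lemma hub_jls_sel [simp]:
  "states hub_jls = {0, 1, 2}" "init hub_jls = 0" "actions hub_jls = {0, 1}"
  "transition hub_jls s \<sigma> s' = of_bool (s' = (if s = 0 then Suc \<sigma> else 0))"
  "jls_dim hub_jls = 2"
  "jls_mat hub_jls s = mat_diag 2 (\<lambda>i. of_bool (s = 0 \<or> s = Suc i))"
  by (simp_all add: hub_jls_def)

lemma is_mdp_jls_hub: "is_mdp_jls hub_jls"
  by (auto simp: is_mdp_jls_def is_mdp_def is_distribution_on_def)

lemma is_policy_hub_iff: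
  "is_policy hub_jls \<pi> \<longleftrightarrow> (\<forall>s\<in>{0, 1, 2}. 0 \<le> \<pi> s 0 \<and> 0 \<le> \<pi> s 1 \<and> \<pi> s 0 + \<pi> s 1 = 1)"
  by (auto simp: is_policy_def available_def is_distribution_on_def)

text \<open>On a spoke both actions lead to the hub, so their probabilities add up to 1 and the
  policy matters at the hub only.\<close>

lemma transfer_hub:
  assumes "is_policy hub_jls \<pi>"
  shows "transfer (induced_mjls hub_jls \<pi>) w g 0 = w 0 * (\<pi> 0 0 * g 1 + \<pi> 0 1 * g 2)"
    and "s \<in> {1, 2} \<Longrightarrow> transfer (induced_mjls hub_jls \<pi>) w g s = w s * g 0"
  using assms
  by (auto simp: transfer_def induced_mjls_def induced_prob_def is_policy_hub_iff
      simp flip: distrib_right)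

text \<open>A round trip from the hub keeps the product of coordinates \<open>i\<close> and
  \<open>j\<close> only if the spoke keeps both. This has probability \<open>\<pi> 0 i\<close> if
  \<open>i = j\<close>, and is impossible otherwise. The hub applies the identity, so an odd time
  repeats the preceding even one.\<close>

lemma second_moment_hub:
  fixes \<pi> i j
  defines "q \<equiv> (if i = j then \<pi> 0 i else 0)"
  assumes \<pi>: "is_policy hub_jls \<pi>" and x0: "x0 \<in> carrier_vec 2" and ij: "i < 2" "j < 2"
  shows "second_moment (induced_mjls hub_jls \<pi>) x0 (2 * k) $$ (i, j) = q ^ k * (x0 $ i * x0 $ j)"
    and "second_moment (induced_mjls hub_jls \<pi>) x0 (Suc (2 * k)) $$ (i, j)
      = q ^ k * (x0 $ i * x0 $ j)"
proof -
  let ?J = "induced_mjls hub_jls \<pi>"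
  let ?d = "\<lambda>s i. of_bool (s = 0 \<or> s = Suc i) :: real"
  define Q where "Q = transfer ?J (\<lambda>s. ?d s i * ?d s j)"
  have mdp: "is_mdp hub_jls" using is_mdp_jls_hub by (simp add: is_mdp_jls_def)
  have distr: "is_distribution_on (modes ?J) (mode_prob ?J s)" if "s \<in> modes ?J" for s
    using induced_prob_distribution[OF mdp \<pi>] that by (simp add: induced_mjls_def)
  have moment: "second_moment ?J x0 k $$ (i, j) = (Q ^^ k) (\<lambda>_. 1) 0 * (x0 $ i * x0 $ j)" for k
    using second_moment_diag[of ?J ?d x0 i j k] distr x0 ij by (simp add: induced_mjls_def Q_def)
  have two: "Q (Q g) 0 = q * g 0" for g
    using ij by (auto simp: transfer_hub[OF \<pi>] q_def Q_def less_2_cases_iff)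
  have "Q (\<lambda>_. 1) 0 = 1"
    using \<pi> by (simp add: transfer_hub is_policy_hub_iff Q_def)
  then have "(Q ^^ (2 * k)) (\<lambda>_. 1) 0 = q ^ k" "(Q ^^ Suc (2 * k)) (\<lambda>_. 1) 0 = q ^ k"
    by (induction k) (simp_all add: two)
  then show "second_moment ?J x0 (2 * k) $$ (i, j) = q ^ k * (x0 $ i * x0 $ j)"
    and "second_moment ?J x0 (Suc (2 * k)) $$ (i, j) = q ^ k * (x0 $ i * x0 $ j)"
    by (simp_all only: moment)
qed

lemma mean_square_stable_hub_iff:
  assumes \<pi>: "is_policy hub_jls \<pi>"
  shows "mean_square_stable (induced_mjls hub_jls \<pi>) \<longleftrightarrow> \<pi> 0 0 < 1 \<and> \<pi> 0 1 < 1"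
proof -
  let ?J = "induced_mjls hub_jls \<pi>"
  have dim: "sys_dim ?J = 2" by (simp add: induced_mjls_def)
  have carrier: "second_moment ?J x0 k \<in> carrier_mat 2 2" for x0 k
    by (simp add: second_moment_def dim)
  have stable_iff: "mean_square_stable ?J \<longleftrightarrow>
      (\<forall>x0\<in>carrier_vec 2. \<forall>i<2. \<forall>j<2. (\<lambda>k. second_moment ?J x0 k $$ (i, j)) \<longlonglongrightarrow> 0)"
    unfolding mean_square_stable_def dim
    by (simp add: mat_inf_norm_tendsto_0_iff[OF carrier])
  show ?thesis
  proof
    assume stable: "mean_square_stable ?J"
    have "\<pi> 0 i < 1" if i: "i < 2" for i
    proof (rule ccontr)
      assume "\<not> \<pi> 0 i < 1"
      then have one: "\<pi> 0 i = 1"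
        using \<pi> i by (auto simp: is_policy_hub_iff less_2_cases_iff)
      \<comment> \<open>Starting along the coordinate that always survives, this entry is constantly
        1 at even times.\<close>
      have "(\<lambda>k. second_moment ?J (unit_vec 2 i) k $$ (i, i)) \<longlonglongrightarrow> 0"
        using stable i by (simp add: stable_iff)
      then have "(\<lambda>k. second_moment ?J (unit_vec 2 i) (2 * k) $$ (i, i)) \<longlonglongrightarrow> 0"
        by (rule filterlim_compose) (simp add: filterlim_subseq strict_mono_def)
      then show False
        using i one by (simp add: second_moment_hub[OF \<pi>] LIMSEQ_const_iff)
    qed
    from this[of 0] this[of 1] show "\<pi> 0 0 < 1 \<and> \<pi> 0 1 < 1" by simp
  next
    assume less: "\<pi> 0 0 < 1 \<and> \<pi> 0 1 < 1"
    show "mean_square_stable ?J"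
      unfolding stable_iff
    proof (intro ballI allI impI)
      fix x0 :: "real vec" and i j :: nat
      assume x0: "x0 \<in> carrier_vec 2" and ij: "i < 2" "j < 2"
      define q where "q = (if i = j then \<pi> 0 i else 0)"
      \<comment> \<open>All entries are geometric with ratio \<open>q\<close>; off the diagonal the
        ratio is 0.\<close>
      have "\<bar>q\<bar> < 1"
        using \<pi> less ij by (auto simp: q_def is_policy_hub_iff less_2_cases_iff)
      then have lim: "(\<lambda>k. q ^ k * (x0 $ i * x0 $ j)) \<longlonglongrightarrow> 0"
        by (intro tendsto_mult_left_zero LIMSEQ_power_zero) simp
      show "(\<lambda>k. second_moment ?J x0 k $$ (i, j)) \<longlonglongrightarrow> 0"
        by (rule limseq_even_odd)
          (use lim in \<open>simp_all add: second_moment_hub[OF \<pi> x0 ij] q_def\<close>)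
    qed
  qed
qed

theorem mainTheorem8:
  shows "\<exists>M :: (nat, nat) mdp_jls. is_mdp_jls M \<and>
           (\<forall>\<pi>. is_deterministic_policy M \<pi> \<longrightarrow> \<not> mean_square_stable (induced_mjls M \<pi>)) \<and>
           (\<exists>\<pi>. is_policy M \<pi> \<and> mean_square_stable (induced_mjls M \<pi>))"
proof (intro exI[of _ hub_jls] conjI allI impI is_mdp_jls_hub)
  fix \<pi> assume "is_deterministic_policy hub_jls \<pi>"
  \<comment> \<open>The action chosen at the hub has probability 1, which violates one of the two
    strict inequalities.\<close>
  then show "\<not> mean_square_stable (induced_mjls hub_jls \<pi>)"
    by (auto simp: is_deterministic_policy_def mean_square_stable_hub_iff)
next
  have "is_policy hub_jls (\<lambda>_ _. 1 / 2)"
    by (simp add: is_policy_hub_iff)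
  then show "\<exists>\<pi>. is_policy hub_jls \<pi> \<and> mean_square_stable (induced_mjls hub_jls \<pi>)"
    by (auto simp: mean_square_stable_hub_iff intro!: exI[of _ "\<lambda>_ _. 1 / 2"])
qed

end
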